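(* Let $R$ be a commutative ring with nonzero identity and let $\delta$ be an expansion function of ideals of $R$. Suppose that $R$ admits a $1$-absorbing $\delta$-primary ideal that is not a $\delta$-primary ideal. Then $R$ is a local ring.
   Context: $\mathcal{I}(R)$ denotes the set of all ideals of $R$. A function $\delta:\mathcal{I}(R)\to\mathcal{I}(R)$ is an expansion function of ideals of $R$ (ideal expansion) if $L\subseteq\delta(L)$ for every ideal $L$, and $J\subseteq I$ implies $\delta(J)\subseteq\delta(I)$ for all ideals $I,J$. A proper ideal $I$ of $R$ is $1$-absorbing $\delta$-primary if whenever $a,b,c\in R$ are nonunits with $abc\in I$, then $ab\in I$ or $c\in\delta(I)$. A proper ideal $I$ of $R$ is $\delta$-primary if whenever $a,b\in R$ with $ab\in I$, then $a\in I$ or $b\in\delta(I)$. A local ring is a ring with exactly one maximal ideal (no Noetherian assumption). *)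

theory Defs
  imports "HOL-Algebra.Ideal"
begin

text \<open>
  Only the values of \<open>\<delta>\<close> on ideals matter: it represents a map from the set of ideals
  of \<open>R\<close> to itself, and its values on other sets are arbitrary.
\<close>

definition ideal_expansion :: "('a, 'm) ring_scheme \<Rightarrow> ('a set \<Rightarrow> 'a set) \<Rightarrow> bool" where
  "ideal_expansion R \<delta> \<longleftrightarrow>
     (\<forall>L. ideal L R \<longrightarrow> ideal (\<delta> L) R) \<and>
     (\<forall>L. ideal L R \<longrightarrow> L \<subseteq> \<delta> L) \<and>
     (\<forall>I J. ideal I R \<longrightarrow> ideal J R \<longrightarrow> J \<subseteq> I \<longrightarrow> \<delta> J \<subseteq> \<delta> I)"

definition proper_ideal :: "'a set \<Rightarrow> ('a, 'm) ring_scheme \<Rightarrow> bool" where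
  "proper_ideal I R \<longleftrightarrow> ideal I R \<and> I \<noteq> carrier R"

definition nonunits :: "('a, 'm) ring_scheme \<Rightarrow> 'a set" where
  "nonunits R = carrier R - Units R"

definition one_absorbing_delta_primary ::
    "('a, 'm) ring_scheme \<Rightarrow> ('a set \<Rightarrow> 'a set) \<Rightarrow> 'a set \<Rightarrow> bool" where
  "one_absorbing_delta_primary R \<delta> I \<longleftrightarrow>
     proper_ideal I R \<and>
     (\<forall>a \<in> nonunits R. \<forall>b \<in> nonunits R. \<forall>c \<in> nonunits R.
        a \<otimes>\<^bsub>R\<^esub> b \<otimes>\<^bsub>R\<^esub> c \<in> I \<longrightarrow> a \<otimes>\<^bsub>R\<^esub> b \<in> I \<or> c \<in> \<delta> I)"

definition delta_primary ::
    "('a, 'm) ring_scheme \<Rightarrow> ('a set \<Rightarrow> 'a set) \<Rightarrow> 'a set \<Rightarrow> bool" where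
  "delta_primary R \<delta> I \<longleftrightarrow>
     proper_ideal I R \<and>
     (\<forall>a \<in> carrier R. \<forall>b \<in> carrier R. a \<otimes>\<^bsub>R\<^esub> b \<in> I \<longrightarrow> a \<in> I \<or> b \<in> \<delta> I)"

definition local_ring :: "('a, 'm) ring_scheme \<Rightarrow> bool" where
  "local_ring R \<longleftrightarrow> cring R \<and> (\<exists>!M. maximalideal M R)"

end

theory Submission
  imports Defs
begin

text \<open>
  Let \<open>I\<close> be 1-absorbing \<open>\<delta>\<close>-primary and let \<open>a b \<in> I\<close> with \<open>a \<notin> I\<close> and \<open>b \<notin> \<delta> I\<close>; then \<open>a\<close> and
  \<open>b\<close> are nonunits. For a nonunit \<open>r\<close>, applying the hypothesis to \<open>r a b \<in> I\<close> gives \<open>r a \<in> I\<close>.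
  So the colon ideal \<open>(I : a)\<close>, which is proper, contains every nonunit and hence every proper
  ideal.
\<close>

context cring
begin

text \<open>A unit \<open>x\<close> in \<open>J\<close> would put the product of
  \<open>inv x\<close> and \<open>x\<close>, that is \<open>\<one>\<close>, into
  \<open>J\<close>.\<close>

lemma proper_ideal_subset_nonunits:
  assumes "proper_ideal J R"
  shows "J \<subseteq> nonunits R"
proof
  fix x assume x: "x \<in> J"
  interpret J: ideal J R using assms unfolding proper_ideal_def by blast
  have "x \<notin> Units R"
  proof
    assume "x \<in> Units R"
    then have "\<one> \<in> J"
      using J.I_l_closed[OF x, of "inv x"] by simp
    with assms show False
      unfolding proper_ideal_def by (simp add: J.one_imp_carrier)
  qed
  with x show "x \<in> nonunits R"
    by (simp add: nonunits_def J.Icarr)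
qed

text \<open>This is the colon ideal \<open>(I : a)\<close>, later used as the candidate for the
  maximal ideal.\<close>

lemma ideal_colon_element:
  assumes "ideal I R" "a \<in> carrier R"
  shows "ideal {r \<in> carrier R. r \<otimes> a \<in> I} R"
proof -
  interpret I: ideal I R by fact
  show ?thesis
  proof (rule idealI[OF ring_axioms])
    show "subgroup {r \<in> carrier R. r \<otimes> a \<in> I} (add_monoid R)"
      using assms(2)
      \<comment> \<open>Folding \<open>a_inv_def\<close> turns the inverse of
        \<open>add_monoid R\<close> into ring negation, so that \<open>l_minus\<close>
        applies.\<close>
      by unfold_locales (auto simp: l_distr l_minus I.a_closed I.a_inv_closed simp flip: a_inv_def)
  next
    fix r x assume r: "r \<in> {r \<in> carrier R. r \<otimes> a \<in> I}" and x: "x \<in> carrier R"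
    have "x \<otimes> (r \<otimes> a) \<in> I" using r x I.I_l_closed by simp
    then show "x \<otimes> r \<in> {r \<in> carrier R. r \<otimes> a \<in> I}"
      using r x assms(2) by (simp add: m_assoc)
    then show "r \<otimes> x \<in> {r \<in> carrier R. r \<otimes> a \<in> I}"
      using r x by (simp add: m_comm)
  qed
qed

text \<open>Proper ideals consist of nonunits, so all of them lie in \<open>N\<close>. Thus
  \<open>N\<close> is the greatest proper ideal, which makes it the unique maximal one.\<close>

lemma local_ring_if_nonunits_subset_proper_ideal:
  assumes N: "proper_ideal N R" and sub: "nonunits R \<subseteq> N"
  shows "local_ring R"
proof -
  have idN: "ideal N R" and neN: "carrier R \<noteq> N"
    using N unfolding proper_ideal_def by auto
  have le: "J \<subseteq> N" if "ideal J R" "J \<noteq> carrier R" for J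
    using proper_ideal_subset_nonunits[of J] that sub unfolding proper_ideal_def by blast
  have "maximalideal N R"
    by (rule maximalidealI[OF idN neN]) (use le in blast)
  moreover have "M = N" if "maximalideal M R" for M
  proof -
    interpret M: maximalideal M R by fact
    have "M \<subseteq> N" using le[OF M.ideal_axioms] M.I_notcarr by blast
    then show ?thesis
      using M.I_maximal[OF idN] neN ideal.Icarr[OF idN] by blast
  qed
  ultimately show ?thesis
    unfolding local_ring_def using cring_axioms by blast
qed

end

theorem theorem2p6:
  fixes R :: "('a, 'm) ring_scheme" and \<delta> :: "'a set \<Rightarrow> 'a set"
  assumes "cring R"
    and "\<one>\<^bsub>R\<^esub> \<noteq> \<zero>\<^bsub>R\<^esub>"
    and "ideal_expansion R \<delta>"
    and "\<exists>I. one_absorbing_delta_primary R \<delta> I \<and> \<not> delta_primary R \<delta> I"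
  shows "local_ring R"
proof -
  interpret cring R by fact
  obtain I where abs: "one_absorbing_delta_primary R \<delta> I" and "\<not> delta_primary R \<delta> I"
    using assms(4) by blast
  then have "ideal I R"
    unfolding one_absorbing_delta_primary_def proper_ideal_def by blast
  then interpret I: ideal I R .
  obtain a b where ab: "a \<in> carrier R" "b \<in> carrier R" "a \<otimes>\<^bsub>R\<^esub> b \<in> I" "a \<notin> I" "b \<notin> \<delta> I"
    using abs \<open>\<not> delta_primary R \<delta> I\<close>
    unfolding one_absorbing_delta_primary_def delta_primary_def by blast
  have "I \<subseteq> \<delta> I"
    using assms(3) \<open>ideal I R\<close> unfolding ideal_expansion_def by blast
  \<comment> \<open>Cancelling a unit \<open>a\<close> from the product would put \<open>b\<close>
    in \<open>I\<close>, hence in \<open>\<delta> I\<close>. Below, cancelling a unit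
    \<open>b\<close> would put \<open>a\<close> in \<open>I\<close>.\<close>
  have "a \<notin> Units R"
  proof
    assume a: "a \<in> Units R"
    have "inv\<^bsub>R\<^esub> a \<otimes>\<^bsub>R\<^esub> (a \<otimes>\<^bsub>R\<^esub> b) \<in> I"
      using I.I_l_closed ab(3) a by simp
    then have "b \<in> I" using a ab(1,2) by (simp flip: m_assoc)
    with \<open>I \<subseteq> \<delta> I\<close> ab(5) show False by blast
  qed
  have "b \<notin> Units R"
  proof
    assume b: "b \<in> Units R"
    have "a \<otimes>\<^bsub>R\<^esub> b \<otimes>\<^bsub>R\<^esub> inv\<^bsub>R\<^esub> b \<in> I"
      using I.I_r_closed ab(3) b by simp
    then have "a \<in> I" using b ab(1,2) by (simp add: m_assoc)
    with ab(4) show False by blast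
  qed
  \<comment> \<open>The colon ideal is proper because \<open>\<one>\<close> in \<open>N\<close>
    would mean that \<open>a\<close> is in \<open>I\<close>.\<close>
  define N where "N = {r \<in> carrier R. r \<otimes>\<^bsub>R\<^esub> a \<in> I}"
  have "\<one>\<^bsub>R\<^esub> \<notin> N" using ab(1,4) by (simp add: N_def)
  then have "proper_ideal N R"
    using ideal_colon_element[OF \<open>ideal I R\<close> ab(1)] one_closed
    unfolding proper_ideal_def N_def[symmetric] by blast
  moreover have "nonunits R \<subseteq> N"
  proof
    fix r assume r: "r \<in> nonunits R"
    then have rc: "r \<in> carrier R" by (simp add: nonunits_def)
    have "r \<otimes>\<^bsub>R\<^esub> a \<otimes>\<^bsub>R\<^esub> b \<in> I"
      using I.I_l_closed[OF ab(3) rc] rc ab(1,2) by (simp add: m_assoc)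
    \<comment> \<open>The factor \<open>b\<close> stands in the third place of the triple, so the
      alternative \<open>b \<in> \<delta> I\<close> is excluded by its choice.\<close>
    then have "r \<otimes>\<^bsub>R\<^esub> a \<in> I"
      using abs r ab(1,2,5) \<open>a \<notin> Units R\<close> \<open>b \<notin> Units R\<close>
      unfolding one_absorbing_delta_primary_def nonunits_def by blast
    with rc show "r \<in> N" by (simp add: N_def)
  qed
  ultimately show ?thesis
    by (rule local_ring_if_nonunits_subset_proper_ideal)
qed

end
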